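(* Let $\mathfrak g$ be a $6$-dimensional real nilpotent Lie algebra with a 1-abelian complex structure $J_M$, where $M\in M_2(\mathbb C)$ is a singular matrix of rank $1$ and $J_M$ is of maximal type. Then there exists a basis $\{\sigma^i\}_{i=1}^3$ of $\mathfrak g^{1,0}$ such that the complex structure equations are $$J^3_{s1}:\quad d\sigma^1=d\sigma^2=0,\qquad d\sigma^3=\sigma^{1\bar 2}.$$
   Context: For a complex structure $J$ on a real Lie algebra $\mathfrak g$, $\mathfrak g^{1,0}\subset\mathfrak g^*_{\mathbb C}$ is the space of $(1,0)$-forms and $d$ is the Chevalley–Eilenberg differential. We write $\sigma^{j\bar k}=\sigma^j\wedge\overline{\sigma^k}$. $J$ is abelian if $[Jx,Jy]=[x,y]$ for all $x,y$. An abelian complex structure on a $2n$-dimensional nilpotent Lie algebra is 1-abelian if $h^{1,0}=\dim\ker(\bar\partial:\mathfrak g^{1,0}\to\bigwedge^{1,1}\mathfrak g^* )$ equals $n-1$. For every 1-abelian complex structure there are a basis $\{\omega^i\}_{i=1}^n$ of $\mathfrak g^{1,0}$ and a nonzero $M\in M_{n-1}(\mathbb C)$ with $d\omega^1=\dots=d\omega^{n-1}=0$ and $d\omega^n=\sum_{j,k=1}^{n-1}M_{jk}\,\omega^{j\bar k}$; the structure is then denoted $J_M$. Maximal type. Let $M$ be a singular $k\times k$ complex matrix and $m_1=k-\mathrm{rank}(M)$. Choose an invertible $S$ such that the last $m_1$ rows of $SM$ vanish, and write $SMS^*=\begin{pmatrix}M'&N\\0&0_{m_1}\end{pmatrix}$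 with $M'$ of size $k-m_1$ ($S^*$ denotes conjugate transpose); put $m_2=\mathrm{rank}(N)$ (this does not depend on $S$). $J_M$ is of maximal type if $m_1=m_2$. *)

theory Defs
  imports
    Complex_Main
    "HOL-Library.Function_Algebras"
    "Jordan_Normal_Form.DL_Rank"
    "Jordan_Normal_Form.Schur_Decomposition"
begin

text \<open>The vector operations on a real vector space \<open>'g\<close> together with a bracket
  \<open>br\<close> on all of \<open>'g\<close> make up a real Lie algebra.\<close>

definition lie_algebra :: "('g::real_vector \<Rightarrow> 'g \<Rightarrow> 'g) \<Rightarrow> bool" where
  "lie_algebra br \<longleftrightarrow>
     (\<forall>x. linear (br x)) \<and> (\<forall>y. linear (\<lambda>x. br x y)) \<and>
     (\<forall>x. br x x = 0) \<and>
     (\<forall>x y z. br x (br y z) + br y (br z x) + br z (br x y) = 0)"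

fun lower_central :: "('g::real_vector \<Rightarrow> 'g \<Rightarrow> 'g) \<Rightarrow> nat \<Rightarrow> 'g set" where
  "lower_central br 0 = UNIV"
| "lower_central br (Suc k) = span {br x y |x y. y \<in> lower_central br k}"

definition nilpotent_lie :: "('g::real_vector \<Rightarrow> 'g \<Rightarrow> 'g) \<Rightarrow> bool" where
  "nilpotent_lie br \<longleftrightarrow> lie_algebra br \<and> (\<exists>k. lower_central br k = {0})"

text \<open>Integrability is the vanishing of the Nijenhuis tensor.\<close>

definition complex_structure :: "('g::real_vector \<Rightarrow> 'g \<Rightarrow> 'g) \<Rightarrow> ('g \<Rightarrow> 'g) \<Rightarrow> bool" where
  "complex_structure br J \<longleftrightarrow>
     linear J \<and> (\<forall>x. J (J x) = - x) \<and>
     (\<forall>x y. br (J x) (J y) - J (br (J x) y) - J (br x (J y)) - br x y = 0)"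

definition abelian_complex_structure ::
    "('g::real_vector \<Rightarrow> 'g \<Rightarrow> 'g) \<Rightarrow> ('g \<Rightarrow> 'g) \<Rightarrow> bool" where
  "abelian_complex_structure br J \<longleftrightarrow>
     complex_structure br J \<and> (\<forall>x y. br (J x) (J y) = br x y)"

text \<open>Complex-linear forms on the complexification of \<open>'g\<close> are identified with their
  restrictions to \<open>'g\<close>: complex \<open>k\<close>-forms are the alternating real-multilinear
  complex-valued functions of \<open>k\<close> arguments in \<open>'g\<close>.  They live in the following
  complex vector spaces of functions.\<close>

global_interpretation form1: Vector_Spaces.vector_space
  "\<lambda>(c::complex) (\<alpha> :: 'g \<Rightarrow> complex) x. c * \<alpha> x"
  by (rule Vector_Spaces.vector_space.intro; intro ext; simp add: distrib_left distrib_right)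

global_interpretation form2: Vector_Spaces.vector_space
  "\<lambda>(c::complex) (F :: 'g \<Rightarrow> 'g \<Rightarrow> complex) x y. c * F x y"
  by (rule Vector_Spaces.vector_space.intro; intro ext; simp add: distrib_left distrib_right)

definition forms10 :: "('g::real_vector \<Rightarrow> 'g) \<Rightarrow> ('g \<Rightarrow> complex) set" where
  "forms10 J = {\<alpha>. linear \<alpha> \<and> (\<forall>x. \<alpha> (J x) = \<i> * \<alpha> x)}"

definition cnj_form :: "('g \<Rightarrow> complex) \<Rightarrow> 'g \<Rightarrow> complex" where
  "cnj_form \<alpha> = (\<lambda>x. cnj (\<alpha> x))"

definition wedge :: "('g \<Rightarrow> complex) \<Rightarrow> ('g \<Rightarrow> complex) \<Rightarrow> 'g \<Rightarrow> 'g \<Rightarrow> complex" where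
  "wedge \<alpha> \<beta> = (\<lambda>x y. \<alpha> x * \<beta> y - \<alpha> y * \<beta> x)"

definition wedge_bar :: "('g \<Rightarrow> complex) \<Rightarrow> ('g \<Rightarrow> complex) \<Rightarrow> 'g \<Rightarrow> 'g \<Rightarrow> complex" where
  "wedge_bar \<alpha> \<beta> = wedge \<alpha> (cnj_form \<beta>)"

definition ce_d :: "('g \<Rightarrow> 'g \<Rightarrow> 'g) \<Rightarrow> ('g::real_vector \<Rightarrow> complex) \<Rightarrow> 'g \<Rightarrow> 'g \<Rightarrow> complex" where
  "ce_d br \<alpha> = (\<lambda>x y. - \<alpha> (br x y))"

definition forms11 :: "('g::real_vector \<Rightarrow> 'g) \<Rightarrow> ('g \<Rightarrow> 'g \<Rightarrow> complex) set" where
  "forms11 J = form2.span {wedge_bar \<alpha> \<beta> |\<alpha> \<beta>. \<alpha> \<in> forms10 J \<and> \<beta> \<in> forms10 J}"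

definition forms20_02 :: "('g::real_vector \<Rightarrow> 'g) \<Rightarrow> ('g \<Rightarrow> 'g \<Rightarrow> complex) set" where
  "forms20_02 J = form2.span
     ({wedge \<alpha> \<beta> |\<alpha> \<beta>. \<alpha> \<in> forms10 J \<and> \<beta> \<in> forms10 J} \<union>
      {wedge (cnj_form \<alpha>) (cnj_form \<beta>) |\<alpha> \<beta>. \<alpha> \<in> forms10 J \<and> \<beta> \<in> forms10 J})"

text \<open>The \<open>(1,1)\<close>-component of \<open>d \<alpha>\<close>; existence and uniqueness are shown in
  \<open>dbar_ex1\<close> below.\<close>

definition dbar :: "('g \<Rightarrow> 'g \<Rightarrow> 'g) \<Rightarrow> ('g::real_vector \<Rightarrow> 'g) \<Rightarrow>
    ('g \<Rightarrow> complex) \<Rightarrow> 'g \<Rightarrow> 'g \<Rightarrow> complex" where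
  "dbar br J \<alpha> = (THE \<phi>. \<phi> \<in> forms11 J \<and> ce_d br \<alpha> - \<phi> \<in> forms20_02 J)"

lemma imaginary_unit_mult: "\<i> * u * (\<i> * v) = - (u * v)"
  by (simp add: complex_eq_iff algebra_simps)

lemma forms11_J: "F \<in> forms11 J \<Longrightarrow> F (J x) (J y) = F x y"
  unfolding forms11_def
proof (induction arbitrary: x y rule: form2.span_induct_alt)
  case base
  show ?case by simp
next
  case (step c F G)
  obtain \<alpha> \<beta> where F: "F = wedge_bar \<alpha> \<beta>" "\<alpha> \<in> forms10 J" "\<beta> \<in> forms10 J"
    using step(1) by blast
  have "F (J x) (J y) = F x y"
    using F by (simp add: wedge_bar_def wedge_def cnj_form_def forms10_def imaginary_unit_mult)
  then show ?case
    by (simp add: step(2))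
qed

lemma forms20_02_J: "F \<in> forms20_02 J \<Longrightarrow> F (J x) (J y) = - F x y"
  unfolding forms20_02_def
proof (induction arbitrary: x y rule: form2.span_induct_alt)
  case base
  show ?case by simp
next
  case (step c F G)
  have "F (J x) (J y) = - F x y"
    using step(1)
  proof (elim UnE CollectE exE conjE)
    fix \<alpha> \<beta>
    assume "F = wedge \<alpha> \<beta>" "\<alpha> \<in> forms10 J" "\<beta> \<in> forms10 J"
    then show ?thesis
      by (simp add: wedge_def forms10_def imaginary_unit_mult)
  next
    fix \<alpha> \<beta>
    assume "F = wedge (cnj_form \<alpha>) (cnj_form \<beta>)" "\<alpha> \<in> forms10 J" "\<beta> \<in> forms10 J"
    then show ?thesis
      by (simp add: wedge_def cnj_form_def forms10_def imaginary_unit_mult)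
  qed
  then show ?case
    by (simp add: step(2))
qed

definition has_11_part :: "('g::real_vector \<Rightarrow> 'g) \<Rightarrow> ('g \<Rightarrow> 'g \<Rightarrow> complex) \<Rightarrow> bool" where
  "has_11_part J F \<longleftrightarrow> (\<exists>\<phi>. \<phi> \<in> forms11 J \<and> F - \<phi> \<in> forms20_02 J)"

lemma has_11_partI: "\<phi> \<in> forms11 J \<Longrightarrow> \<psi> \<in> forms20_02 J \<Longrightarrow> F = \<psi> + \<phi> \<Longrightarrow> has_11_part J F"
  unfolding has_11_part_def by (rule exI[of _ \<phi>]) simp

lemma has_11_partE:
  assumes "has_11_part J F"
  obtains \<phi> \<psi> where "\<phi> \<in> forms11 J" "\<psi> \<in> forms20_02 J" "F = \<psi> + \<phi>"
  using assms unfolding has_11_part_def by (metis diff_add_cancel)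

lemma has_11_part_zero: "has_11_part J (\<lambda>x y. 0)"
proof (rule has_11_partI)
  show "0 \<in> forms11 J" "0 \<in> forms20_02 J"
    by (simp_all only: forms20_02_def forms11_def form2.span_zero)
qed (intro ext, simp)

lemma has_11_part_add:
  assumes "has_11_part J F" "has_11_part J G"
  shows "has_11_part J (\<lambda>x y. F x y + G x y)"
proof -
  obtain \<phi> \<psi> where 1: "\<phi> \<in> forms11 J" "\<psi> \<in> forms20_02 J" "F = \<psi> + \<phi>"
    using assms(1) by (rule has_11_partE)
  obtain \<phi>' \<psi>' where 2: "\<phi>' \<in> forms11 J" "\<psi>' \<in> forms20_02 J" "G = \<psi>' + \<phi>'"
    using assms(2) by (rule has_11_partE)
  show ?thesis
  proof (rule has_11_partI)
    show "\<phi> + \<phi>' \<in> forms11 J" "\<psi> + \<psi>' \<in> forms20_02 J"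
      using 1 2 unfolding forms11_def forms20_02_def by (blast intro: form2.span_add)+
  qed (intro ext, simp add: 1(3) 2(3))
qed

lemma has_11_part_scale:
  assumes "has_11_part J F"
  shows "has_11_part J (\<lambda>x y. c * F x y)"
proof -
  obtain \<phi> \<psi> where 1: "\<phi> \<in> forms11 J" "\<psi> \<in> forms20_02 J" "F = \<psi> + \<phi>"
    using assms by (rule has_11_partE)
  show ?thesis
  proof (rule has_11_partI)
    show "(\<lambda>x y. c * \<phi> x y) \<in> forms11 J" "(\<lambda>x y. c * \<psi> x y) \<in> forms20_02 J"
      using 1 unfolding forms11_def forms20_02_def by (auto intro: form2.span_scale)
  qed (intro ext, simp add: 1(3) distrib_left)
qed

lemma has_11_part_sum:
  assumes "finite B" "\<And>b. b \<in> B \<Longrightarrow> has_11_part J (F b)"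
  shows "has_11_part J (\<lambda>x y. \<Sum>b\<in>B. F b x y)"
  using assms
  by (induction B rule: finite_induct) (simp_all add: has_11_part_zero has_11_part_add)

lemma linear_split_10_01:
  fixes J :: "'g::real_vector \<Rightarrow> 'g" and e :: "'g \<Rightarrow> complex"
  assumes J: "linear J" "\<And>x. J (J x) = - x" and e: "linear e"
  obtains a b where "a \<in> forms10 J" "b \<in> forms10 J" "e = (\<lambda>x. a x + cnj_form b x)"
proof
  have [simp]: "e (- x) = - e x" "e (x + y) = e x + e y" "e (c *\<^sub>R x) = c *\<^sub>R e x"
    "J (x + y) = J x + J y" "J (c *\<^sub>R x) = c *\<^sub>R J x" for x y c
    using J e by (simp_all add: linear_neg linear_add linear_scale)
  show "(\<lambda>x. (e x - \<i> * e (J x)) / 2) \<in> forms10 J"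
    by (auto simp: forms10_def J(2) ring_distribs add_divide_distrib diff_divide_distrib
        scaleR_conv_of_real intro!: linearI)
  show "(\<lambda>x. cnj ((e x + \<i> * e (J x)) / 2)) \<in> forms10 J"
    by (auto simp: forms10_def J(2) ring_distribs add_divide_distrib diff_divide_distrib
        scaleR_conv_of_real intro!: linearI)
  show "e = (\<lambda>x. (e x - \<i> * e (J x)) / 2 + cnj_form (\<lambda>x. cnj ((e x + \<i> * e (J x)) / 2)) x)"
    by (intro ext) (simp add: cnj_form_def diff_divide_distrib add_divide_distrib)
qed

lemma has_11_part_wedge:
  fixes J :: "'g::real_vector \<Rightarrow> 'g" and e f :: "'g \<Rightarrow> complex"
  assumes J: "linear J" "\<And>x. J (J x) = - x" and e: "linear e" and f: "linear f"
  shows "has_11_part J (wedge e f)"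
proof -
  obtain a b where ab: "a \<in> forms10 J" "b \<in> forms10 J" "e = (\<lambda>x. a x + cnj_form b x)"
    using linear_split_10_01[OF J e] .
  obtain c d where cd: "c \<in> forms10 J" "d \<in> forms10 J" "f = (\<lambda>x. c x + cnj_form d x)"
    using linear_split_10_01[OF J f] .
  show ?thesis
  proof (rule has_11_partI)
    show "wedge_bar a d - wedge_bar c b \<in> forms11 J"
      unfolding forms11_def by (rule form2.span_diff; rule form2.span_base) (use ab cd in blast)+
    show "wedge a c + wedge (cnj_form b) (cnj_form d) \<in> forms20_02 J"
      unfolding forms20_02_def by (rule form2.span_add; rule form2.span_base) (use ab cd in blast)+
  qed (intro ext, simp add: ab(3) cd(3) wedge_def wedge_bar_def ring_distribs)
qed

lemma dbar_ex1:
  fixes br :: "'g::real_vector \<Rightarrow> 'g \<Rightarrow> 'g"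
  assumes br: "lie_algebra br" and J: "complex_structure br J"
    and dim: "0 < dim (UNIV :: 'g set)" and \<alpha>: "linear \<alpha>"
  shows "\<exists>!\<phi>. \<phi> \<in> forms11 J \<and> ce_d br \<alpha> - \<phi> \<in> forms20_02 J"
proof -
  have Jl: "linear J" and JJ: "J (J x) = - x" for x
    using J by (auto simp: complex_structure_def)
  obtain B :: "'g set" where B: "independent B" "span B = UNIV"
      and cB: "card B = dim (UNIV :: 'g set)"
    using real_vector.basis_exists[of "UNIV :: 'g set"] by (metis top.extremum_uniqueI)
  have fin: "finite B"
    using dim cB card_gt_0_iff by metis
  define r where "r b x = representation B x b" for b x
  define e where "e b x = complex_of_real (r b x)" for b x
  have rl: "linear (r b)" for b
    unfolding r_def
    by (rule linearI) (use B in \<open>simp_all add: real_vector.representation_add real_vector.representation_scale\<close>)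
  have el: "linear (e b)" for b
    by (rule linearI) (simp_all add: e_def linear_add[OF rl] linear_scale[OF rl] scaleR_conv_of_real)
  define F where "F = ce_d br \<alpha>"
  have bl: "linear (br x)" "linear (\<lambda>x. br x y)" "br x x = 0" for x y
    using br unfolding lie_algebra_def by blast+
  have brs: "br (x + y) z = br x z + br y z" "br (c *\<^sub>R x) z = c *\<^sub>R br x z"
    "br x (y + z) = br x y + br x z" "br x (c *\<^sub>R z) = c *\<^sub>R br x z" "br x x = 0" for x y z c
    using linear_add[OF bl(1)] linear_scale[OF bl(1)] linear_add[OF bl(2)] linear_scale[OF bl(2)] bl(3)
    by blast+
  have l1: "linear (\<lambda>x. F x y)" and l2: "linear (F x)" and alt0: "F x x = 0" for x y
    unfolding F_def ce_d_def
    by (auto intro!: linearI simp: brs linear_add[OF \<alpha>] linear_scale[OF \<alpha>] linear_0[OF \<alpha>])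
  have alt: "F y x = - F x y" for x y
    using alt0[of "x + y"] alt0[of x] alt0[of y]
    by (simp add: linear_add[OF l1] linear_add[OF l2] add_eq_0_iff)
  have rep: "x = (\<Sum>b\<in>B. r b x *\<^sub>R b)" for x
    unfolding r_def using real_vector.sum_representation_eq[OF B(1) _ fin, of x] B(2) by simp
  have ex: "F x y = (\<Sum>b\<in>B. \<Sum>c\<in>B. e b x * e c y * F b c)" for x y
  proof -
    have "F x y = (\<Sum>b\<in>B. r b x *\<^sub>R F b y)"
      by (subst rep[of x]) (simp add: linear_sum[OF l1] linear_scale[OF l1])
    also have "\<dots> = (\<Sum>b\<in>B. r b x *\<^sub>R (\<Sum>c\<in>B. r c y *\<^sub>R F b c))"
      by (subst rep[of y]) (simp add: linear_sum[OF l2] linear_scale[OF l2])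
    finally show ?thesis
      by (simp add: e_def scaleR_conv_of_real sum_distrib_left mult.assoc)
  qed
  have "F = (\<lambda>x y. \<Sum>b\<in>B. \<Sum>c\<in>B. F b c / 2 * wedge (e b) (e c) x y)"
  proof (intro ext)
    fix x y
    have "F x y = (F x y - F y x) / 2"
      by (simp add: alt[of y x])
    also have "\<dots> = (\<Sum>b\<in>B. \<Sum>c\<in>B. F b c / 2 * wedge (e b) (e c) x y)"
      unfolding ex[of x y] ex[of y x] sum_subtractf[symmetric] sum_divide_distrib
      by (intro sum.cong refl) (simp add: wedge_def field_simps)
    finally show "F x y = (\<Sum>b\<in>B. \<Sum>c\<in>B. F b c / 2 * wedge (e b) (e c) x y)" .
  qed
  moreover have "has_11_part J (\<lambda>x y. \<Sum>b\<in>B. \<Sum>c\<in>B. F b c / 2 * wedge (e b) (e c) x y)"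
    by (intro has_11_part_sum has_11_part_scale has_11_part_wedge fin Jl JJ el)
  ultimately have "has_11_part J F"
    by simp
  moreover have "\<phi> = \<psi>" if "\<phi> \<in> forms11 J" "F - \<phi> \<in> forms20_02 J" "\<psi> \<in> forms11 J" "F - \<psi> \<in> forms20_02 J"
    for \<phi> \<psi>
  proof (intro ext)
    fix x y
    have "\<phi> (J x) (J y) = \<phi> x y" "\<psi> (J x) (J y) = \<psi> x y"
      using that by (auto intro: forms11_J)
    moreover have "(F - \<phi>) (J x) (J y) = - (F - \<phi>) x y" "(F - \<psi>) (J x) (J y) = - (F - \<psi>) x y"
      using that by (blast intro: forms20_02_J)+
    ultimately show "\<phi> x y = \<psi> x y"
      by (simp add: algebra_simps)
  qed
  ultimately show ?thesis
    unfolding has_11_part_def F_def by blast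
qed

definition h10 :: "('g \<Rightarrow> 'g \<Rightarrow> 'g) \<Rightarrow> ('g::real_vector \<Rightarrow> 'g) \<Rightarrow> nat" where
  "h10 br J = form1.dim {\<alpha> \<in> forms10 J. dbar br J \<alpha> = 0}"

text \<open>\<open>h10 = n - 1\<close> is written without the truncated subtraction of natural numbers;
  in particular \<open>n\<close> is positive, so the condition on \<open>dim\<close> makes \<open>'g\<close>
  finite-dimensional.\<close>

definition one_abelian :: "nat \<Rightarrow> ('g \<Rightarrow> 'g \<Rightarrow> 'g) \<Rightarrow> ('g::real_vector \<Rightarrow> 'g) \<Rightarrow> bool" where
  "one_abelian n br J \<longleftrightarrow>
     dim (UNIV :: 'g set) = 2 * n \<and> nilpotent_lie br \<and>
     abelian_complex_structure br J \<and> h10 br J + 1 = n"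

definition basis10 :: "('g::real_vector \<Rightarrow> 'g) \<Rightarrow> nat \<Rightarrow> (nat \<Rightarrow> 'g \<Rightarrow> complex) \<Rightarrow> bool" where
  "basis10 J n \<sigma> \<longleftrightarrow>
     inj_on \<sigma> {1..n} \<and> form1.independent (\<sigma> ` {1..n}) \<and> form1.span (\<sigma> ` {1..n}) = forms10 J"

text \<open>\<open>J\<close> is a \<open>J\<^sub>M\<close>.  Matrix entries are numbered from 0, basis
  forms from 1.\<close>

definition is_J_M :: "nat \<Rightarrow> ('g \<Rightarrow> 'g \<Rightarrow> 'g) \<Rightarrow> ('g::real_vector \<Rightarrow> 'g) \<Rightarrow> complex mat \<Rightarrow> bool" where
  "is_J_M n br J M \<longleftrightarrow>
     one_abelian n br J \<and> M \<in> carrier_mat (n - 1) (n - 1) \<and> M \<noteq> 0\<^sub>m (n - 1) (n - 1) \<and>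
     (\<exists>\<omega>. basis10 J n \<omega> \<and>
        (\<forall>i\<in>{1..<n}. ce_d br (\<omega> i) = 0) \<and>
        ce_d br (\<omega> n) =
          (\<lambda>x y. \<Sum>j\<in>{1..<n}. \<Sum>k\<in>{1..<n}. M $$ (j - 1, k - 1) * wedge_bar (\<omega> j) (\<omega> k) x y))"

text \<open>The requirement \<open>m\<^sub>1 = m\<^sub>2\<close> for a singular \<open>k\<close> by \<open>k\<close> matrix \<open>M\<close>; \<open>m\<^sub>2 = rank N\<close>
  does not depend on the choice of \<open>S\<close>.\<close>

definition maximal_type :: "nat \<Rightarrow> complex mat \<Rightarrow> bool" where
  "maximal_type k M \<longleftrightarrow>
     M \<in> carrier_mat k k \<and> \<not> invertible_mat M \<and>
     (let m\<^sub>1 = k - vec_space.rank k M in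
      \<exists>S M' N. S \<in> carrier_mat k k \<and> invertible_mat S \<and>
        (\<forall>i\<in>{k - m\<^sub>1..<k}. row (S * M) i = 0\<^sub>v k) \<and>
        M' \<in> carrier_mat (k - m\<^sub>1) (k - m\<^sub>1) \<and> N \<in> carrier_mat (k - m\<^sub>1) m\<^sub>1 \<and>
        S * M * mat_adjoint S = four_block_mat M' N (0\<^sub>m m\<^sub>1 (k - m\<^sub>1)) (0\<^sub>m m\<^sub>1 m\<^sub>1) \<and>
        vec_space.rank (k - m\<^sub>1) N = m\<^sub>1)"

end

theory Submission
  imports Defs
begin

text \<open>
  A rank-one matrix is an outer product, \<open>M j k = u j * cnj (v k)\<close>, and \<open>wedge_bar\<close> is linear in
  its first and conjugate-linear in its second argument.  Hence the sum
  \<open>\<Sum>j k. M j k * wedge_bar (\<omega> j) (\<omega> k)\<close> collapses to the single term \<open>wedge_bar \<sigma>1 \<sigma>2\<close> with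
  \<open>\<sigma>1 = \<Sum>j. u j * \<omega> j\<close> and \<open>\<sigma>2 = \<Sum>k. v k * \<omega> k\<close>; both forms are closed because the
  \<open>\<omega> j\<close> are.  They form a basis of \<open>forms10 J\<close> together with \<open>\<omega> 3\<close> exactly when the vectors
  \<open>u\<close> and \<open>v\<close> are linearly independent.

  This independence is what maximal type provides.  Let \<open>s\<close> be the second row of \<open>S\<close>.  It
  annihilates \<open>M\<close> from the left, so \<open>s \<cdot> u = 0\<close>; and the block \<open>N\<close> is a nonzero scalar that has
  \<open>cnj (s \<cdot> v)\<close> as a factor.  Thus \<open>u\<close> lies in the kernel of \<open>s\<close> and \<open>v\<close> does not, which for
  \<open>u \<noteq> 0\<close> rules out proportionality (\<open>maximal_type_rank1_factorisation\<close>).  That the new forms are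
  a basis then follows from Cramer's rule and a dimension count (\<open>basis10_if_generating\<close>).
\<close>

lemma mult_mat_2_entry:
  assumes "A \<in> carrier_mat 2 2" "B \<in> carrier_mat 2 2" "i < 2" "j < 2"
  shows "(A * B) $$ (i, j) = A $$ (i, 0) * B $$ (0, j) + A $$ (i, 1) * B $$ (1, j)"
  using assms by (simp add: scalar_prod_def numeral_2_eq_2)

text \<open>If \<open>S T = T S = 1\<close> and only the first row \<open>w\<close> of \<open>S M\<close> is nonzero, then \<open>M = T (S M)\<close> is the
  outer product of the first column of \<open>T\<close> with \<open>w\<close>.\<close>

lemma maximal_type_rank1_factorisation:
  fixes M :: "complex mat"
  assumes rank: "vec_space.rank 2 M = 1" and max: "maximal_type 2 M"
  obtains u v :: "nat \<Rightarrow> complex"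
  where "\<And>j k. j < 2 \<Longrightarrow> k < 2 \<Longrightarrow> M $$ (j, k) = u j * cnj (v k)"
    and "u 0 * v 1 \<noteq> u 1 * v 0"
proof -
  have M: "M \<in> carrier_mat 2 2"
    using max by (simp add: maximal_type_def)
  have "(2::nat) - vec_space.rank 2 M = 1"
    using rank by simp
  then obtain S M' N where S: "S \<in> carrier_mat 2 2" and inv: "invertible_mat S"
    and row0: "\<forall>i\<in>{2 - 1..<2}. row (S * M) i = 0\<^sub>v 2"
    and M': "M' \<in> carrier_mat (2 - 1) (2 - 1)" and N: "N \<in> carrier_mat (2 - 1) 1"
    and block: "S * M * mat_adjoint S = four_block_mat M' N (0\<^sub>m 1 (2 - 1)) (0\<^sub>m 1 1)"
    and rankN: "vec_space.rank (2 - 1) N = 1"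
    using max unfolding maximal_type_def Let_def by metis
  obtain T where ST: "S * T = 1\<^sub>m 2" and TS: "T * S = 1\<^sub>m (dim_row T)"
    using inv S by (auto simp: invertible_mat_def inverts_mat_def)
  have "dim_row T = 2" "dim_col T = 2"
    using arg_cong[OF TS, of dim_col] arg_cong[OF ST, of dim_col] S by auto
  then have T: "T \<in> carrier_mat 2 2"
    by auto
  define u where "u j = T $$ (j, 0)" for j
  define v where "v k = cnj ((S * M) $$ (0, k))" for k
  have SM: "S * M \<in> carrier_mat 2 2"
    using S M by simp
  have SM1: "(S * M) $$ (1, k) = 0" if "k < 2" for k
  proof -
    have "row (S * M) 1 $ k = 0"
      using row0 that by simp
    then show ?thesis
      using that S M by simp
  qed
  have fact: "M $$ (j, k) = u j * cnj (v k)" if jk: "j < 2" "k < 2" for j k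
  proof -
    have "M = T * (S * M)"
      using TS T S M by (simp flip: assoc_mult_mat[of T 2 2 S 2 M 2])
    then have "M $$ (j, k) = (T * (S * M)) $$ (j, k)"
      by simp
    also have "\<dots> = T $$ (j, 0) * (S * M) $$ (0, k) + T $$ (j, 1) * (S * M) $$ (1, k)"
      by (rule mult_mat_2_entry) (use T SM jk in auto)
    finally show ?thesis
      unfolding SM1[OF jk(2)] by (simp add: u_def v_def del: index_mult_mat)
  qed
  have ST_entry: "S $$ (i, 0) * u 0 + S $$ (i, 1) * u 1 = (if i = 0 then 1 else 0)" if "i < 2" for i
    using that arg_cong[OF ST, of "\<lambda>A. A $$ (i, 0)"] mult_mat_2_entry[OF S T that, of 0]
    by (simp add: u_def)
  have "N \<noteq> 0\<^sub>m (2 - 1) 1"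
    using rankN by (metis vec_space.rank_0I zero_neq_one)
  then have N0: "N $$ (0, 0) \<noteq> 0"
    using N by (auto simp: mat_eq_iff)
  have adj: "mat_adjoint S \<in> carrier_mat 2 2"
    and adj_entry: "\<And>k. k < 2 \<Longrightarrow> mat_adjoint S $$ (k, 1) = cnj (S $$ (1, k))"
    using S by (auto simp: mat_adjoint_def mat_of_rows_def)
  have "N $$ (0, 0) = (S * M * mat_adjoint S) $$ (0, 1)"
    using M' N by (simp add: block)
  also have "\<dots> = cnj (v 0 * S $$ (1, 0) + v 1 * S $$ (1, 1))"
    by (subst mult_mat_2_entry[OF SM adj])
      (simp_all add: v_def adj_entry del: index_mult_mat One_nat_def)
  finally have s_v: "v 0 * S $$ (1, 0) + v 1 * S $$ (1, 1) \<noteq> 0"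
    using N0 by (metis complex_cnj_zero)
  have "u 0 * v 1 \<noteq> u 1 * v 0"
  proof
    assume parallel: "u 0 * v 1 = u 1 * v 0"
    have s_u: "S $$ (1, 0) * u 0 + S $$ (1, 1) * u 1 = 0"
      using ST_entry[of 1] by simp
    \<comment> \<open>With \<open>s\<close> the second row of \<open>S\<close>, the vector \<open>(s \<cdot> v) u - (s \<cdot> u) v\<close> has
      \<open>u 0 * v 1 - u 1 * v 0\<close> as a factor, so that \<open>(s \<cdot> v) u = 0\<close>.\<close>
    have "u 0 * (v 0 * S $$ (1, 0) + v 1 * S $$ (1, 1)) =
        v 0 * (S $$ (1, 0) * u 0 + S $$ (1, 1) * u 1) + S $$ (1, 1) * (u 0 * v 1 - u 1 * v 0)"
      by (simp add: algebra_simps)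
    moreover have "u 1 * (v 0 * S $$ (1, 0) + v 1 * S $$ (1, 1)) =
        v 1 * (S $$ (1, 0) * u 0 + S $$ (1, 1) * u 1) - S $$ (1, 0) * (u 0 * v 1 - u 1 * v 0)"
      by (simp add: algebra_simps)
    ultimately have "u 0 = 0" "u 1 = 0"
      using s_v unfolding s_u parallel by simp_all
    then show False
      using ST_entry[of 0] by simp
  qed
  with fact show thesis
    by (rule that)
qed

text \<open>A repeated or redundant \<open>\<sigma> i\<close> would leave at most \<open>n - 1\<close> generators for a space of
  dimension \<open>n\<close>.\<close>

lemma basis10_if_generating:
  assumes \<omega>: "basis10 J n \<omega>"
    and in10: "\<And>i. i \<in> {1..n} \<Longrightarrow> \<sigma> i \<in> forms10 J"
    and gen: "\<And>i. i \<in> {1..n} \<Longrightarrow> \<omega> i \<in> form1.span (\<sigma> ` {1..n})"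
  shows "basis10 J n \<sigma>"
proof -
  let ?B = "\<sigma> ` {1..n}"
  have span\<omega>: "form1.span (\<omega> ` {1..n}) = forms10 J"
    and ind\<omega>: "form1.independent (\<omega> ` {1..n})" and inj\<omega>: "inj_on \<omega> {1..n}"
    using \<omega> by (auto simp: basis10_def)
  have "form1.subspace (forms10 J)"
    unfolding span\<omega>[symmetric] by (rule form1.subspace_span)
  then have "form1.span ?B \<subseteq> forms10 J"
    using in10 by (intro form1.span_minimal) auto
  moreover have "forms10 J \<subseteq> form1.span ?B"
    unfolding span\<omega>[symmetric]
    by (rule form1.span_minimal) (use gen in \<open>auto simp: form1.subspace_span\<close>)
  ultimately have span\<sigma>: "form1.span ?B = forms10 J"
    by blast
  have "form1.dim (forms10 J) = n"
    using form1.dim_eq_card[of "\<omega> ` {1..n}" "forms10 J"] ind\<omega> span\<omega> card_image[OF inj\<omega>]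
    by (metis form1.span_span card_atLeastAtMost diff_Suc_1)
  then have min_card: "n \<le> card C" if "?B \<subseteq> form1.span C" "finite C" for C
    using form1.dim_le_card[of ?B C] that span\<sigma> form1.dim_span[of ?B] by simp
  have "n \<le> card ?B"
    by (rule min_card) (auto intro: form1.span_base)
  then have cardB: "card ?B = card {1..n}"
    using card_image_le[of "{1..n}" \<sigma>] by simp
  have "form1.independent ?B"
  proof
    assume "form1.dependent ?B"
    then obtain b where b: "b \<in> ?B" "b \<in> form1.span (?B - {b})"
      unfolding form1.dependent_def by blast
    have "?B \<subseteq> form1.span (?B - {b})"
    proof
      fix c
      assume "c \<in> ?B"
      then show "c \<in> form1.span (?B - {b})"
        using b(2) by (cases "c = b") (simp_all add: form1.span_base)
    qed
    then have "n \<le> card (?B - {b})"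
      by (rule min_card) simp
    then show False
      using b(1) cardB card_Diff1_less[of ?B b] by simp
  qed
  moreover have "inj_on \<sigma> {1..n}"
    using cardB by (simp add: eq_card_imp_inj_on)
  ultimately show ?thesis
    using span\<sigma> by (simp add: basis10_def)
qed

theorem theorem4p10:
  fixes br :: "'g::real_vector \<Rightarrow> 'g \<Rightarrow> 'g" and J :: "'g \<Rightarrow> 'g" and M :: "complex mat"
  assumes "dim (UNIV :: 'g set) = 6"
    and "nilpotent_lie br"
    and "is_J_M 3 br J M"
    and "M \<in> carrier_mat 2 2"
    and "\<not> invertible_mat M"
    and "vec_space.rank 2 M = 1"
    and "maximal_type 2 M"
  shows "\<exists>\<sigma>. basis10 J 3 \<sigma> \<and>
           ce_d br (\<sigma> 1) = 0 \<and> ce_d br (\<sigma> 2) = 0 \<and>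
           ce_d br (\<sigma> 3) = wedge_bar (\<sigma> 1) (\<sigma> 2)"
proof -
  obtain \<omega> where \<omega>: "basis10 J 3 \<omega>" and closed: "\<forall>i\<in>{1..<3}. ce_d br (\<omega> i) = 0"
    and d3: "ce_d br (\<omega> 3) = (\<lambda>x y. \<Sum>j\<in>{1..<3}. \<Sum>k\<in>{1..<3}.
                 M $$ (j - 1, k - 1) * wedge_bar (\<omega> j) (\<omega> k) x y)"
    using assms(3) by (auto simp: is_J_M_def)
  obtain u v where M: "\<And>j k. j < 2 \<Longrightarrow> k < 2 \<Longrightarrow> M $$ (j, k) = u j * cnj (v k)"
    and uv: "u 0 * v 1 \<noteq> u 1 * v 0"
    using maximal_type_rank1_factorisation[OF assms(6,7)] by blast
  define comb where "comb a = (\<lambda>x. a 0 * \<omega> 1 x + a 1 * \<omega> 2 x)" for a :: "nat \<Rightarrow> complex"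
  define \<sigma> where "\<sigma> i = (if i = 1 then comb u else if i = 2 then comb v else \<omega> 3)" for i :: nat
  have ind: "{1..<3} = {1, 2::nat}" "{1..3} = {1, 2, 3::nat}"
    by auto
  have span_lin: "(\<lambda>x. a * \<alpha> x + b * \<beta> x) \<in> form1.span A"
    if "\<alpha> \<in> form1.span A" "\<beta> \<in> form1.span A" for a b \<alpha> \<beta> and A :: "('g \<Rightarrow> complex) set"
    using form1.span_add[OF form1.span_scale[OF that(1), of a] form1.span_scale[OF that(2), of b]]
    by (simp add: plus_fun_def)
  have \<omega>10: "\<omega> i \<in> form1.span (\<omega> ` {1..3})" if "i \<in> {1..3}" for i
    using that by (auto intro: form1.span_base)
  have basis: "basis10 J 3 \<sigma>"
  proof (rule basis10_if_generating[OF \<omega>])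
    have "comb a \<in> form1.span (\<omega> ` {1..3})" for a
      unfolding comb_def by (intro span_lin \<omega>10) auto
    moreover have "form1.span (\<omega> ` {1..3}) = forms10 J"
      using \<omega> by (simp add: basis10_def)
    ultimately show "\<sigma> i \<in> forms10 J" if "i \<in> {1..3}" for i
      using that \<omega>10[of 3] by (auto simp: \<sigma>_def)
  next
    fix i :: nat
    assume i: "i \<in> {1..3}"
    have s: "\<sigma> j \<in> form1.span (\<sigma> ` {1..3})" if "j \<in> {1..3}" for j
      using that by (auto intro: form1.span_base)
    let ?D = "u 0 * v 1 - u 1 * v 0"
    have D: "?D \<noteq> 0"
      using uv by simp
    \<comment> \<open>Cramer's rule for the coefficients of \<open>\<omega> 1\<close> and \<open>\<omega> 2\<close>.\<close>
    have "\<omega> 1 = (\<lambda>x. (v 1 / ?D) * \<sigma> 1 x + (- u 1 / ?D) * \<sigma> 2 x)"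
      using D by (intro ext) (simp add: \<sigma>_def comb_def divide_simps, simp add: algebra_simps)
    then have 1: "\<omega> 1 \<in> form1.span (\<sigma> ` {1..3})"
      by (rule ssubst) (intro span_lin s; simp)
    have "\<omega> 2 = (\<lambda>x. (- v 0 / ?D) * \<sigma> 1 x + (u 0 / ?D) * \<sigma> 2 x)"
      using D by (intro ext) (simp add: \<sigma>_def comb_def divide_simps, simp add: algebra_simps)
    then have 2: "\<omega> 2 \<in> form1.span (\<sigma> ` {1..3})"
      by (rule ssubst) (intro span_lin s; simp)
    have 3: "\<omega> 3 \<in> form1.span (\<sigma> ` {1..3})"
      using s[of 3] by (simp add: \<sigma>_def)
    show "\<omega> i \<in> form1.span (\<sigma> ` {1..3})"
      using i 1 2 3 unfolding ind(2) by blast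
  qed
  have "ce_d br (\<omega> 1) x y = 0" "ce_d br (\<omega> 2) x y = 0" for x y
    using closed by auto
  then have "ce_d br (comb a) = 0" for a
    by (intro ext) (simp add: ce_d_def comb_def)
  then have "ce_d br (\<sigma> 1) = 0" "ce_d br (\<sigma> 2) = 0"
    by (simp_all add: \<sigma>_def)
  moreover have "ce_d br (\<sigma> 3) = wedge_bar (\<sigma> 1) (\<sigma> 2)"
  proof (intro ext)
    fix x y
    have "ce_d br (\<omega> 3) x y =
        u 0 * cnj (v 0) * wedge_bar (\<omega> 1) (\<omega> 1) x y +
        u 0 * cnj (v 1) * wedge_bar (\<omega> 1) (\<omega> 2) x y +
        (u 1 * cnj (v 0) * wedge_bar (\<omega> 2) (\<omega> 1) x y +
         u 1 * cnj (v 1) * wedge_bar (\<omega> 2) (\<omega> 2) x y)"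
      unfolding d3 ind(1) by (simp add: M)
    then show "ce_d br (\<sigma> 3) x y = wedge_bar (\<sigma> 1) (\<sigma> 2) x y"
      by (simp add: \<sigma>_def comb_def wedge_bar_def wedge_def cnj_form_def algebra_simps)
  qed
  ultimately show ?thesis
    using basis by blast
qed

end
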